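(* Let $L=L^{(1)}\oplus L^{(2)}$ be a step-2 Carnot algebra with 3 generators, let $X_1,X_2,X_3$ be a basis of $L^{(1)}$, and let $G$ be the connected simply connected Lie group with Lie algebra $L$. Suppose that $U\subset\mathbb{R}^3$ is strictly convex and compact, and contains the origin in its interior. Consider the left-invariant time-optimal problem $$\dot q=\sum_{i=1}^3u_iX_i,\quad q\in G,\quad u=(u_1,u_2,u_3)\in U,\qquad q(0)=\mathrm{id},\quad q(t_1)=q_1,\qquad t_1\to\min.$$ Then all normal extremal controls $u(t)$ of this problem are constant or periodic, and continuous.
   Context: A step-2 Carnot algebra with 3 generators is a finite-dimensional real Lie algebra $L=L^{(1)}\oplus L^{(2)}$ with $\dim L^{(1)}=3$, $[L^{(1)},L^{(1)}]=L^{(2)}$ and $[L,L^{(2)}]=0$. The elements $X_i$ are regarded as left-invariant vector fields on $G$. For $\lambda\in T^*G$ put $h_i(\lambda)=\langle\lambda,X_i\rangle$ and $h_{ij}(\lambda)=\langle\lambda,[X_i,X_j]\rangle$, $1\le i,j\le3$. Let $H(h_1,h_2,h_3)=\max_{v\in U}\sum_{i=1}^3v_ih_i$ be the support function of $U$; since $U$ is strictly convex, $H$ is $C^1$ on $\mathbb{R}^3\setminus\{0\}$. A control $u(t)\in U$ (measurable, bounded) is a normal extremal control if there is a Lipschitz curve $\lambda_t\in T^*G$ over the corresponding trajectory $q(t)$ that satisfies the Pontryagin maximum principle: for almost every $t$, $$\dot h_i=-\sum_{j=1}^3u_jh_{ij},\qquad \dot h_{ij}=0,\qquad \dot q=\sum_{i=1}^3u_iX_i,$$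 together with the maximality condition $$\sum_{i=1}^3u_i(t)h_i(\lambda_t)=\max_{v\in U}\sum_{i=1}^3v_ih_i(\lambda_t)=H(h(\lambda_t)),\qquad h(\lambda_t)=(h_1(\lambda_t),h_2(\lambda_t),h_3(\lambda_t)),$$ and with $H(h(\lambda_t))\equiv\mathrm{const}>0$ (normality). By strict convexity of $U$, such a control is given by $u(t)=\nabla H(h(\lambda_t))$. Controls are identified when they coincide for almost every $t$; a control given on a time interval is called periodic if it is the restriction to that interval of a periodic function on $\mathbb{R}$. *)

theory Defs
  imports "HOL-Analysis.Analysis" "HOL-Library.Periodic_Fun"
begin

text \<open>
  The Lie algebra is carried by a type of class \<open>euclidean_space\<close>; this class only
  supplies finite dimension and the usual topology. No metric compatible with the bracket is
  assumed, and none of the notions below depends on the inner product of the type.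
\<close>

locale lie_algebra =
  fixes br :: "'a::euclidean_space \<Rightarrow> 'a \<Rightarrow> 'a"
  assumes bilinear_br: "bilinear br"
    and br_self: "br x x = 0"
    and jacobi: "br x (br y z) + br y (br z x) + br z (br x y) = 0"

text \<open>The second layer may be zero, which is the abelian case.\<close>

locale carnot_algebra_step2_gen3 = lie_algebra br
  for br :: "'a::euclidean_space \<Rightarrow> 'a \<Rightarrow> 'a" +
  fixes L1 L2 :: "'a set"
  assumes subspace_L1: "subspace L1"
    and subspace_L2: "subspace L2"
    and layers_sum: "\<exists>y\<in>L1. \<exists>z\<in>L2. x = y + z"
    and layers_disjoint: "L1 \<inter> L2 = {0}"
    and dim_L1: "dim L1 = 3"
    and br_L1_L1: "span {br x y |x y. x \<in> L1 \<and> y \<in> L1} = L2"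
    and br_L_L2: "z \<in> L2 \<Longrightarrow> br x z = 0"

text \<open>
  The connected simply connected Lie group of a nilpotent Lie algebra, in exponential
  coordinates: the underlying manifold is the vector space itself, the identity is \<open>0\<close>, and
  for step 2 the Baker--Campbell--Hausdorff series of the product ends after the first bracket.
\<close>

definition gmult :: "('a::euclidean_space \<Rightarrow> 'a \<Rightarrow> 'a) \<Rightarrow> 'a \<Rightarrow> 'a \<Rightarrow> 'a" where
  "gmult br x y = x + y + (1/2) *\<^sub>R br x y"

definition left_field :: "('a::euclidean_space \<Rightarrow> 'a \<Rightarrow> 'a) \<Rightarrow> 'a \<Rightarrow> 'a \<Rightarrow> 'a" where
  "left_field br v q = frechet_derivative (gmult br q) (at 0) v"

text \<open>
  In these coordinates a point of the cotangent bundle is a pair of a base point and a covector,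
  and \<open>hamfun br v\<close> is the function \<open>\<lambda> \<mapsto> \<langle>\<lambda>, v\<rangle>\<close> for the left-invariant field of \<open>v\<close>.
\<close>

definition hamfun ::
    "('a::euclidean_space \<Rightarrow> 'a \<Rightarrow> 'a) \<Rightarrow> 'a \<Rightarrow> 'a \<times> ('a \<Rightarrow>\<^sub>L real) \<Rightarrow> real" where
  "hamfun br v lam = blinfun_apply (snd lam) (left_field br v (fst lam))"

definition hvec ::
    "('a::euclidean_space \<Rightarrow> 'a \<Rightarrow> 'a) \<Rightarrow> (3 \<Rightarrow> 'a) \<Rightarrow> 'a \<times> ('a \<Rightarrow>\<^sub>L real) \<Rightarrow> real^3" where
  "hvec br X lam = (\<chi> i. hamfun br (X i) lam)"

definition is_basis_of :: "('i::finite \<Rightarrow> 'a::real_vector) \<Rightarrow> 'a set \<Rightarrow> bool" where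
  "is_basis_of X V \<longleftrightarrow> inj X \<and> independent (range X) \<and> span (range X) = V"

definition strictly_convex_set :: "'a::euclidean_space set \<Rightarrow> bool" where
  "strictly_convex_set S \<longleftrightarrow>
     (\<forall>x\<in>S. \<forall>y\<in>S. x \<noteq> y \<longrightarrow> open_segment x y \<subseteq> interior S)"

text \<open>For compact nonempty \<open>U\<close> the supremum is attained.\<close>

definition support_fun :: "'a::euclidean_space set \<Rightarrow> 'a \<Rightarrow> real" where
  "support_fun U h = (SUP v\<in>U. v \<bullet> h)"

text \<open>
  The time set \<open>I\<close> may be any interval containing \<open>0\<close>, bounded or not. On a noncompact
  interval, "Lipschitz curve" has to be read on compact subintervals: this is the notion that
  does not depend on coordinates, and the trajectory itself is in general not globally Lipschitz.
\<close>

definition normal_extremal_control ::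
    "('a::euclidean_space \<Rightarrow> 'a \<Rightarrow> 'a) \<Rightarrow> (3 \<Rightarrow> 'a) \<Rightarrow> (real^3) set \<Rightarrow> real set
      \<Rightarrow> (real \<Rightarrow> real^3) \<Rightarrow> bool" where
  "normal_extremal_control br X U I u \<longleftrightarrow>
     u \<in> borel_measurable (lebesgue_on I) \<and> (\<forall>t\<in>I. u t \<in> U) \<and>
     (\<exists>lam :: real \<Rightarrow> 'a \<times> ('a \<Rightarrow>\<^sub>L real).
        (\<forall>a b. {a..b} \<subseteq> I \<longrightarrow> (\<exists>C. C-lipschitz_on {a..b} lam)) \<and>
        fst (lam 0) = 0 \<and>
        (AE t in lebesgue_on I.
           ((\<lambda>s. fst (lam s)) has_vector_derivative
              (\<Sum>i\<in>UNIV. u t $ i *\<^sub>R left_field br (X i) (fst (lam t)))) (at t within I) \<and>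
           (\<forall>i. ((\<lambda>s. hamfun br (X i) (lam s)) has_real_derivative
              - (\<Sum>j\<in>UNIV. u t $ j * hamfun br (br (X i) (X j)) (lam t))) (at t within I)) \<and>
           (\<forall>i j. ((\<lambda>s. hamfun br (br (X i) (X j)) (lam s)) has_real_derivative 0)
              (at t within I)) \<and>
           u t \<bullet> hvec br X (lam t) = support_fun U (hvec br X (lam t))) \<and>
        (\<exists>c>0. \<forall>t\<in>I. support_fun U (hvec br X (lam t)) = c))"

text \<open>
  Every function on a bounded interval is such a restriction, so this is informative only for
  unbounded \<open>I\<close>.
\<close>

definition periodic_control_on :: "real set \<Rightarrow> (real \<Rightarrow> 'b) \<Rightarrow> bool" where
  "periodic_control_on I u \<longleftrightarrow>
     (\<exists>w T. T > 0 \<and> periodic_fun_simple w T \<and> (\<forall>t\<in>I. u t = w t))"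

text \<open>
  The following facts confirm that the coordinate model is the intended one: \<open>gmult br\<close> is a
  group law, the fields \<open>left_field br v\<close> are left-invariant, take the value \<open>v\<close> at the
  identity, and \<open>v \<mapsto> left_field br v\<close> turns \<open>br\<close> into the commutator of vector fields.
\<close>

context carnot_algebra_step2_gen3
begin

lemma br_anti: "br x y = - br y x"
proof -
  have "br (x + y) (x + y) = br x x + br x y + (br y x + br y y)"
    by (simp only: bilinear_ladd[OF bilinear_br] bilinear_radd[OF bilinear_br] ac_simps)
  then show ?thesis by (simp add: br_self eq_neg_iff_add_eq_0)
qed

lemma br_br: "br x (br y z) = 0"
proof -
  obtain a b where y: "y = a + b" "a \<in> L1" "b \<in> L2" using layers_sum by blast
  obtain c d where z: "z = c + d" "c \<in> L1" "d \<in> L2" using layers_sum by blast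
  have "br y z = br a c + br b c + (br a d + br b d)"
    unfolding y(1) z(1) bilinear_ladd[OF bilinear_br] bilinear_radd[OF bilinear_br] ..
  moreover have "br a d = 0" "br b d = 0" "br b c = 0"
    using br_L_L2[OF z(3)] br_L_L2[OF y(3), of c] br_anti[of b c] by auto
  ultimately have "br y z = br a c" by simp
  moreover have "br a c \<in> L2"
    unfolding br_L1_L1[symmetric] using y(2) z(2) by (blast intro: span_base)
  ultimately show ?thesis using br_L_L2 by simp
qed

lemma br_br': "br (br x y) z = 0"
  using br_anti[of "br x y" z] br_br by simp

lemma gmult_assoc: "gmult br (gmult br x y) z = gmult br x (gmult br y z)"
  by (simp add: gmult_def bilinear_ladd[OF bilinear_br] bilinear_radd[OF bilinear_br]
      bilinear_lmul[OF bilinear_br] bilinear_rmul[OF bilinear_br] br_br br_br'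
      algebra_simps)

lemma gmult_0_left: "gmult br 0 x = x" and gmult_0_right: "gmult br x 0 = x"
  using bilinear_br by (simp_all add: gmult_def bilinear_lzero bilinear_rzero)

lemma gmult_minus: "gmult br (- x) x = 0"
  using bilinear_br by (simp add: gmult_def bilinear_lneg br_self)

lemma has_derivative_gmult:
  "(gmult br q has_derivative (\<lambda>v. v + (1/2) *\<^sub>R br q v)) (at x)"
proof -
  have "linear (br q)" using bilinear_br by (simp add: bilinear_def)
  then have "(br q has_derivative br q) (at x)"
    by (rule linear_imp_has_derivative)
  then have "((\<lambda>v. q + v + (1/2) *\<^sub>R br q v) has_derivative
      (\<lambda>v. 0 + v + (1/2) *\<^sub>R br q v)) (at x)"
    by (intro has_derivative_add has_derivative_const has_derivative_ident
        has_derivative_scaleR_right)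
  then show ?thesis by (simp add: gmult_def[abs_def])
qed

lemma left_field_eq: "left_field br v q = v + (1/2) *\<^sub>R br q v"
  unfolding left_field_def frechet_derivative_at[OF has_derivative_gmult, symmetric] by simp

lemma left_field_0: "left_field br v 0 = v"
  using bilinear_br by (simp add: left_field_eq bilinear_lzero)

lemma left_field_invariant:
  "frechet_derivative (gmult br p) (at q) (left_field br v q) = left_field br v (gmult br p q)"
  unfolding frechet_derivative_at[OF has_derivative_gmult, symmetric] left_field_eq gmult_def
  by (simp add: bilinear_ladd[OF bilinear_br] bilinear_radd[OF bilinear_br]
      bilinear_lmul[OF bilinear_br] bilinear_rmul[OF bilinear_br] br_br br_br' algebra_simps)

lemma has_derivative_left_field:
  "(left_field br v has_derivative (\<lambda>w. (1/2) *\<^sub>R br w v)) (at q)"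
proof -
  have "linear (\<lambda>w. br w v)" using bilinear_br by (simp add: bilinear_def)
  then have "((\<lambda>w. br w v) has_derivative (\<lambda>w. br w v)) (at q)"
    by (rule linear_imp_has_derivative)
  then have "((\<lambda>w. v + (1/2) *\<^sub>R br w v) has_derivative
      (\<lambda>w. 0 + (1/2) *\<^sub>R br w v)) (at q)"
    by (intro has_derivative_add has_derivative_const has_derivative_scaleR_right)
  then show ?thesis by (simp add: left_field_eq[abs_def])
qed

lemma left_field_commutator:
  "frechet_derivative (left_field br w) (at q) (left_field br v q)
    - frechet_derivative (left_field br v) (at q) (left_field br w q)
   = left_field br (br v w) q"
  unfolding frechet_derivative_at[OF has_derivative_left_field, symmetric] left_field_eq
  using br_anti[of w v]
  by (simp add: bilinear_ladd[OF bilinear_br] bilinear_radd[OF bilinear_br]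
      bilinear_lmul[OF bilinear_br] bilinear_rmul[OF bilinear_br] br_br br_br'
      flip: scaleR_left_distrib)

end

end

theory Submission
  imports Defs
begin

text \<open>
  The functions \<open>h\<^sub>i\<^sub>j\<close> are constant along an extremal, so the vertical part of the Hamiltonian
  system reads \<open>h' = \<omega> \<times> g(h)\<close> with a fixed vector \<open>\<omega>\<close> and the continuous map \<open>g = \<nabla>H\<close>,
  and \<open>u = g(h)\<close> almost everywhere. Both \<open>\<omega> \<bullet> h\<close> and \<open>H(h)\<close> are conserved: \<open>h\<close> moves in the
  intersection of a plane with the boundary of a convex body. If the plane only touches the body,
  then \<open>g\<close> is constant on the intersection. Otherwise the intersection is a closed convex curve
  around a point \<open>p\<close> with \<open>H(p) < c\<close>; the angular velocity of \<open>h\<close> around \<open>p\<close> is bounded below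
  by a positive constant and depends only on the position on the curve, hence every turn takes the
  same time. Uniqueness of solutions, which could fail for merely continuous \<open>g\<close>, is not needed.
\<close>

section \<open>Derivatives given almost everywhere\<close>

text \<open>One-dimensional Sard theorem for an arbitrary set \<open>S\<close>. Since
  \<open>baby_Sard\<close> asks for a derivative matrix of deficient rank, \<open>f\<close> is
  carried over to \<open>real^1\<close>, where the zero matrix has rank 0 < 1, and the null image is
  projected back.\<close>

lemma negligible_image_real_derivative_zero:
  fixes f :: "real \<Rightarrow> real"
  assumes der: "\<And>t. t \<in> S \<Longrightarrow> (f has_real_derivative 0) (at t within S)"
  shows "negligible (f ` S)"
proof -
  let ?g = "\<lambda>x::real^1. (vec (f (x $ 1)) :: real^1)"
  let ?S = "{x::real^1. x $ 1 \<in> S}"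
  have "(?g has_derivative (\<lambda>_. 0)) (at x within ?S)" if "x \<in> ?S" for x
  proof -
    have lin: "((\<lambda>x::real^1. x $ 1) has_derivative (\<lambda>x. x $ 1)) (at x within ?S)"
      by (rule bounded_linear.has_derivative[OF bounded_linear_vec_nth has_derivative_ident])
    have f: "(f has_derivative (\<lambda>_. 0)) (at (x $ 1) within S)"
      using der[of "x $ 1"] that by (simp add: has_field_derivative_def lambda_zero)
    have "((\<lambda>x::real^1. f (x $ 1)) has_derivative (\<lambda>_. 0)) (at x within ?S)"
      by (rule has_derivative_in_compose2[OF _ _ _ lin, where t=S and g'="\<lambda>_ _. 0"])
        (use der that in \<open>auto simp: has_field_derivative_def lambda_zero\<close>)
    then have "(?g has_derivative (\<lambda>_. vec 0)) (at x within ?S)"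
      by (rule bounded_linear.has_derivative[OF linear_conv_bounded_linear[THEN iffD1, OF linear_vec]])
    then show ?thesis by simp
  qed
  moreover have "matrix (\<lambda>_. 0 :: real^1) = (0 :: real^1^1)"
    by (simp add: matrix_def zero_vec_def)
  then have "rank (matrix (\<lambda>_. 0 :: real^1) :: real^1^1) < CARD(1)"
    by (simp add: rank_0)
  ultimately have "negligible (?g ` ?S)"
    by (intro baby_Sard[where f' = "\<lambda>_ _. 0"]) auto
  then have "negligible ((\<lambda>x. x $ 1) ` (?g ` ?S))"
    by (rule negligible_differentiable_image_negligible[rotated])
      (auto intro: linear_imp_differentiable_on bounded_linear.linear[OF bounded_linear_vec_nth])
  moreover have "(\<lambda>x. x $ 1) ` ?S = S"
  proof
    show "S \<subseteq> (\<lambda>x. x $ 1) ` ?S"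
    proof
      fix s assume "s \<in> S"
      then show "s \<in> (\<lambda>x. x $ 1) ` ?S" by (intro image_eqI[of _ _ "vec s"]) auto
    qed
  qed auto
  moreover have "(\<lambda>x. x $ 1) ` (?g ` ?S) = f ` ((\<lambda>x. x $ 1) ` ?S)"
    unfolding image_image vec_component ..
  ultimately show ?thesis by (simp only:)
qed

text \<open>
  The points with derivative zero have null image by Sard, the others because Lipschitz maps
  preserve null sets; but the image is an interval.
\<close>

lemma lipschitz_derivative_zero_ae_eq:
  fixes f :: "real \<Rightarrow> real"
  assumes lip: "C-lipschitz_on {a..b} f" and "a \<le> b" and neg: "negligible N"
    and der: "\<And>t. t \<in> {a..b} - N \<Longrightarrow> (f has_real_derivative 0) (at t within {a..b})"
  shows "f a = f b"
proof -
  have "negligible (f ` ({a..b} \<inter> N))"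
  proof (rule negligible_locally_Lipschitz_image)
    show "negligible ({a..b} \<inter> N)" using neg by (simp add: negligible_Int)
    fix x assume "x \<in> {a..b} \<inter> N"
    then have "\<forall>y\<in>{a..b} \<inter> N. norm (f y - f x) \<le> C * norm (y - x)"
      using lipschitz_on_normD[OF lip] by auto
    then show "\<exists>T B. open T \<and> x \<in> T \<and>
        (\<forall>y\<in>{a..b} \<inter> N \<inter> T. norm (f y - f x) \<le> B * norm (y - x))"
      by (intro exI[of _ UNIV] exI[of _ C]) auto
  qed simp
  moreover have "negligible (f ` ({a..b} - N))"
    by (rule negligible_image_real_derivative_zero) (blast intro: DERIV_subset der)
  ultimately have "negligible (f ` ({a..b} \<inter> N) \<union> f ` ({a..b} - N))"
    by (rule negligible_Un)
  then have small: "negligible (f ` {a..b})"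
    by (rule negligible_subset) auto
  have "connected (f ` {a..b})"
    by (intro connected_continuous_image lipschitz_on_continuous_on[OF lip]) simp
  then have "{min (f a) (f b)<..<max (f a) (f b)} \<subseteq> f ` {a..b}"
    using \<open>a \<le> b\<close> connectedD_interval[of "f ` {a..b}" "f a" "f b"]
      connectedD_interval[of "f ` {a..b}" "f b" "f a"]
    by (cases "f a \<le> f b") (force simp: min_def max_def)+
  then have "negligible {min (f a) (f b)<..<max (f a) (f b)}"
    using small negligible_subset by blast
  then have "{min (f a) (f b)<..<max (f a) (f b)} = {}"
    using open_not_negligible[OF open_greaterThanLessThan] by blast
  then show ?thesis by (cases "f a \<le> f b") (simp_all add: min_def max_def)
qed

text \<open>Subtracting a primitive \<open>G\<close> of the continuous \<open>g\<close> leaves a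
  Lipschitz function whose derivative vanishes off \<open>N\<close>, hence a constant. So
  \<open>f\<close> inherits the derivative of \<open>G\<close> also at the points of
  \<open>N\<close>.\<close>

lemma lipschitz_derivative_ae_imp_derivative:
  fixes f :: "real \<Rightarrow> real"
  assumes lip: "C-lipschitz_on {a..b} f" and neg: "negligible N"
    and cont: "continuous_on {a..b} g"
    and der: "\<And>t. t \<in> {a..b} - N \<Longrightarrow> (f has_real_derivative g t) (at t within {a..b})"
    and t: "a < t" "t < b"
  shows "(f has_real_derivative g t) (at t)"
proof -
  define G where "G = (\<lambda>x. integral {a..x} g)"
  have G: "(G has_real_derivative g x) (at x within {a..b})" if "x \<in> {a..b}" for x
    unfolding G_def using integral_has_real_derivative[OF cont that] .
  obtain B where B: "\<And>x. x \<in> {a..b} \<Longrightarrow> norm (g x) \<le> B"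
    using compact_continuous_image[OF cont compact_Icc]
    by (metis bounded_iff compact_imp_bounded image_eqI)
  have "\<bar>B\<bar>-lipschitz_on {a..b} G"
  proof (rule lipschitz_onI)
    fix x y assume "x \<in> {a..b}" "y \<in> {a..b}"
    moreover have "norm (g z) \<le> \<bar>B\<bar>" if "z \<in> {a..b}" for z
      using B[OF that] by linarith
    ultimately have "norm (G x - G y) \<le> \<bar>B\<bar> * norm (x - y)"
      using field_differentiable_bound[OF convex_real_interval(5) G] by blast
    then show "dist (G x) (G y) \<le> \<bar>B\<bar> * dist x y" by (simp add: dist_norm)
  qed simp
  then have lipd: "(C + \<bar>B\<bar>)-lipschitz_on {a..b} (\<lambda>x. f x - G x)"
    by (intro lipschitz_on_diff lip)
  have const: "f x = G x + (f a - G a)" if "x \<in> {a..b}" for x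
  proof -
    have "f a - G a = f x - G x"
    proof (rule lipschitz_derivative_zero_ae_eq[OF _ _ neg, where f = "\<lambda>x. f x - G x"])
      show "(C + \<bar>B\<bar>)-lipschitz_on {a..x} (\<lambda>x. f x - G x)"
        by (rule lipschitz_on_subset[OF lipd]) (use that in auto)
      fix s assume s: "s \<in> {a..x} - N"
      then have "((\<lambda>x. f x - G x) has_real_derivative g s - g s) (at s within {a..b})"
        using that by (intro DERIV_diff der G) auto
      then have "((\<lambda>x. f x - G x) has_real_derivative 0) (at s within {a..b})"
        by simp
      then show "((\<lambda>x. f x - G x) has_real_derivative 0) (at s within {a..x})"
        by (rule DERIV_subset) (use that in auto)
    qed (use that in auto)
    then show ?thesis by simp
  qed
  have "((\<lambda>x. G x + (f a - G a)) has_real_derivative g t) (at t within {a..b})"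
    using G[of t] t by (auto intro!: derivative_eq_intros)
  then have "(f has_real_derivative g t) (at t within {a..b})"
    by (rule has_field_derivative_transform_within[OF _ zero_less_one])
      (use t in simp, rule const[symmetric])
  then show ?thesis using t by (simp add: at_within_Icc_at)
qed

section \<open>Support functions of strictly convex sets\<close>

lemma inner_le_support_fun:
  assumes "compact U" "v \<in> U"
  shows "v \<bullet> h \<le> support_fun U h"
proof -
  have "compact ((\<lambda>v. v \<bullet> h) ` U)"
    by (intro compact_continuous_image continuous_intros assms)
  then show ?thesis
    unfolding support_fun_def using assms(2)
    by (intro cSUP_upper bounded_imp_bdd_above compact_imp_bounded)
qed

lemma support_fun_attained:
  assumes "compact U" "U \<noteq> {}"
  obtains v where "v \<in> U" "v \<bullet> h = support_fun U h"
proof -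
  have "continuous_on U (\<lambda>v. v \<bullet> h)" by (intro continuous_intros)
  then obtain v where v: "v \<in> U" "\<And>w. w \<in> U \<Longrightarrow> w \<bullet> h \<le> v \<bullet> h"
    using continuous_attains_sup[OF assms] by blast
  then have "support_fun U h \<le> v \<bullet> h"
    unfolding support_fun_def using assms(2) by (intro cSUP_least)
  then show thesis using that[OF v(1)] inner_le_support_fun[OF assms(1) v(1), of h] by simp
qed

text \<open>The midpoint of two distinct maximizers would be interior to \<open>U\<close>, and a
  small step from it in direction \<open>h\<close> would exceed the maximum.\<close>

lemma strictly_convex_unique_maximizer:
  assumes sc: "strictly_convex_set U" and "compact U" and "h \<noteq> 0"
    and v: "v \<in> U" "v \<bullet> h = support_fun U h" and w: "w \<in> U" "w \<bullet> h = support_fun U h"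
  shows "v = w"
proof (rule ccontr)
  assume "v \<noteq> w"
  then have "midpoint v w \<in> open_segment v w" by simp
  then have "midpoint v w \<in> interior U"
    using sc v(1) w(1) \<open>v \<noteq> w\<close> unfolding strictly_convex_set_def by blast
  then obtain e where e: "0 < e" "cball (midpoint v w) e \<subseteq> U"
    unfolding mem_interior_cball by blast
  let ?x = "midpoint v w + (e / norm h) *\<^sub>R h"
  have "?x \<in> cball (midpoint v w) e"
    using \<open>0 < e\<close> \<open>h \<noteq> 0\<close> by (simp add: dist_norm)
  then have "?x \<bullet> h \<le> support_fun U h"
    using e(2) by (intro inner_le_support_fun assms(2)) blast
  moreover have "?x \<bullet> h = support_fun U h + e * norm h"
    using v(2) w(2) \<open>h \<noteq> 0\<close>
    by (simp add: midpoint_def inner_add_left power2_norm_eq_inner[symmetric] power2_eq_square)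
  ultimately show False using e(1) \<open>h \<noteq> 0\<close> by (simp add: mult_le_0_iff)
qed

text \<open>A ball of radius \<open>r\<close> around the origin lies in \<open>U\<close>; its point
  in direction \<open>h\<close> is tested against \<open>h\<close>. The bound makes level sets of
  the support function bounded.\<close>

lemma support_fun_lower_bound:
  fixes U :: "'a::euclidean_space set"
  assumes "compact U" "0 \<in> interior U"
  obtains r where "0 < r" "\<And>h. r * norm h \<le> support_fun U h"
proof -
  obtain r where r: "0 < r" "cball 0 r \<subseteq> U"
    using assms(2) unfolding mem_interior_cball by blast
  have "r * norm h \<le> support_fun U h" for h
  proof -
    have "(r / norm h) *\<^sub>R h \<in> U" using r by (cases "h = 0") auto
    then have "((r / norm h) *\<^sub>R h) \<bullet> h \<le> support_fun U h"
      by (rule inner_le_support_fun[OF assms(1)])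
    then show ?thesis
      by (cases "h = 0") (simp_all add: power2_norm_eq_inner[symmetric] power2_eq_square)
  qed
  with r(1) show thesis using that by blast
qed

text \<open>Convexity of the support function on the segment from \<open>p\<close> to
  \<open>p + x\<close>, tested with a maximizer \<open>v\<close> at the intermediate point.
  Strictness comes from the positive weight \<open>1 - k\<close> on the smaller value at
  \<open>p\<close>.\<close>

lemma support_fun_scaled_ray_less:
  assumes U: "compact U" "U \<noteq> {}" and "support_fun U p < c" "support_fun U (p + x) = c"
    and k: "0 < k" "k < 1"
  shows "support_fun U (p + k *\<^sub>R x) < c"
proof -
  obtain v where v: "v \<in> U" "v \<bullet> (p + k *\<^sub>R x) = support_fun U (p + k *\<^sub>R x)"
    using support_fun_attained[OF U] by blast
  have "v \<bullet> (p + k *\<^sub>R x) = (1 - k) * (v \<bullet> p) + k * (v \<bullet> (p + x))"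
    by (simp add: inner_add_right algebra_simps)
  also have "\<dots> \<le> (1 - k) * support_fun U p + k * c"
    using k inner_le_support_fun[OF U(1) v(1), of p] inner_le_support_fun[OF U(1) v(1), of "p + x"]
      assms(4) by (intro add_mono mult_left_mono) auto
  also have "\<dots> < c" using assms(3) k mult_strict_left_mono[of "support_fun U p" c "1 - k"]
    by (simp add: algebra_simps)
  finally show ?thesis using v(2) by simp
qed

lemma support_fun_level_ray_unique:
  assumes U: "compact U" "U \<noteq> {}" and "support_fun U p < c"
    and "support_fun U (p + x) = c" "support_fun U (p + k *\<^sub>R x) = c" and "0 < k"
  shows "k = 1"
proof (rule ccontr)
  assume "k \<noteq> 1"
  show False
  proof (cases "k < 1")
    case True
    then show False using support_fun_scaled_ray_less[OF U assms(3,4) \<open>0 < k\<close>] assms(5) by simp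
  next
    case False
    \<comment> \<open>Exchange the two points: \<open>p + x\<close> lies on the segment from
      \<open>p\<close> to \<open>p + k *\<^sub>R x\<close> at parameter
      \<open>inverse k\<close>.\<close>
    then have "inverse k < 1" using \<open>k \<noteq> 1\<close> by (simp add: inverse_less_1_iff)
    then show False
      using support_fun_scaled_ray_less[OF U assms(3,5), of "inverse k"] \<open>0 < k\<close> assms(4) by simp
  qed
qed

text \<open>
  For strictly convex \<open>U\<close> and \<open>h \<noteq> 0\<close> this is the gradient of the support function at \<open>h\<close>;
  at \<open>0\<close> it is an arbitrary point of \<open>U\<close>.
\<close>

definition maximizer :: "'a::euclidean_space set \<Rightarrow> 'a \<Rightarrow> 'a" where
  "maximizer U h = (SOME v. v \<in> U \<and> v \<bullet> h = support_fun U h)"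

lemma maximizer:
  assumes "compact U" "U \<noteq> {}"
  shows maximizer_in: "maximizer U h \<in> U"
    and inner_maximizer: "maximizer U h \<bullet> h = support_fun U h"
proof -
  have "\<exists>v. v \<in> U \<and> v \<bullet> h = support_fun U h"
    using support_fun_attained[OF assms] by blast
  then have "maximizer U h \<in> U \<and> maximizer U h \<bullet> h = support_fun U h"
    unfolding maximizer_def by (rule someI_ex)
  then show "maximizer U h \<in> U" "maximizer U h \<bullet> h = support_fun U h" by auto
qed

lemma maximizer_eqI:
  assumes "strictly_convex_set U" "compact U" "h \<noteq> 0" "v \<in> U" "v \<bullet> h = support_fun U h"
  shows "maximizer U h = v"
  using strictly_convex_unique_maximizer[OF assms(1-3)] maximizer[OF assms(2)] assms(4,5) by blast

text \<open>A map into a compact set is continuous if its graph is closed. This is the continuity of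
  the gradient of the support function away from the origin.\<close>

lemma continuous_on_maximizer:
  fixes U :: "'a::euclidean_space set"
  assumes "strictly_convex_set U" "compact U" "U \<noteq> {}"
  shows "continuous_on (- {0}) (maximizer U)"
proof -
  \<comment> \<open>Pairs whose second component maximizes the pairing with the first, written as an
    intersection of closed conditions, one for each competitor \<open>w\<close>. By uniqueness of
    maximizers, this relation is the graph once the first component is nonzero.\<close>
  let ?C = "{x. snd x \<in> U} \<inter> (\<Inter>w\<in>U. {x. w \<bullet> fst x \<le> snd x \<bullet> fst x})"
  have "closed {x::'a \<times> 'a. snd x \<in> U}"
    using continuous_closed_vimage[OF compact_imp_closed[OF assms(2)], of snd]
    by (simp add: vimage_def)
  then have "closed ?C"
    by (intro closed_Int closed_INT ballI closed_Collect_le continuous_intros)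
  moreover have "(\<lambda>h. (h, maximizer U h)) ` (- {0}) = (- {0}) \<times> U \<inter> ?C"
  proof (intro subset_antisym subsetI)
    fix x assume "x \<in> (\<lambda>h. (h, maximizer U h)) ` (- {0})"
    then show "x \<in> (- {0}) \<times> U \<inter> ?C"
      using maximizer[OF assms(2,3)] inner_le_support_fun[OF assms(2)] by auto
  next
    fix x assume x: "x \<in> (- {0}) \<times> U \<inter> ?C"
    obtain w where w: "w \<in> U" "w \<bullet> fst x = support_fun U (fst x)"
      using support_fun_attained[OF assms(2,3)] by blast
    then have "support_fun U (fst x) \<le> snd x \<bullet> fst x"
      using x by (metis (no_types, lifting) IntD2 INT_E mem_Collect_eq)
    then have "snd x \<bullet> fst x = support_fun U (fst x)"
      using x inner_le_support_fun[OF assms(2), of "snd x" "fst x"] by (simp add: mem_Times_iff)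
    then have "maximizer U (fst x) = snd x"
      using x by (intro maximizer_eqI assms) (simp_all add: mem_Times_iff)
    then show "x \<in> (\<lambda>h. (h, maximizer U h)) ` (- {0})"
      using x by (intro image_eqI[of _ _ "fst x"]) (simp_all add: mem_Times_iff)
  qed
  ultimately have "closedin (top_of_set ((- {0}) \<times> U)) ((\<lambda>h. (h, maximizer U h)) ` (- {0}))"
    by (simp add: closedin_closed_Int)
  then show ?thesis
    by (subst continuous_closed_graph_eq[OF assms(2)]) (use maximizer[OF assms(2,3)] in auto)
qed

section \<open>Periodicity of the vertical flow\<close>

text \<open>
  If \<open>\<sigma> t\<close> is the time at which \<open>\<theta>\<close> has increased by \<open>L\<close> since \<open>t\<close>, then
  \<open>\<sigma>' t = F t / F (\<sigma> t) = 1\<close>. No continuity of the rate is used, so the inverse of \<open>\<theta>\<close>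
  is differentiated instead of integrating \<open>1 / F\<close>.
\<close>

lemma periodic_rate_imp_constant_period:
  fixes \<theta> F :: "real \<Rightarrow> real"
  assumes J: "open J" "J \<noteq> {}" and up: "\<And>s t. t \<in> J \<Longrightarrow> t \<le> s \<Longrightarrow> s \<in> J"
    and der: "\<And>t. t \<in> J \<Longrightarrow> (\<theta> has_real_derivative F t) (at t)"
    and pos: "\<And>t. t \<in> J \<Longrightarrow> \<delta> \<le> F t" "0 < \<delta>" and "0 < L"
    and per: "\<And>s t. s \<in> J \<Longrightarrow> t \<in> J \<Longrightarrow> \<theta> s = \<theta> t + L \<Longrightarrow> F s = F t"
  shows "\<exists>T>0. \<forall>t\<in>J. \<theta> (t + T) = \<theta> t + L"
proof -
  have growth: "\<delta> * (t - s) \<le> \<theta> t - \<theta> s" if "s \<in> J" "s < t" for s t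
  proof -
    have "\<exists>z>s. z < t \<and> \<theta> t - \<theta> s = (t - s) * F z"
      using that up by (intro MVT2 der) auto
    then obtain z where "s < z" "\<theta> t - \<theta> s = (t - s) * F z" by blast
    then show ?thesis using pos(1)[OF up[OF \<open>s \<in> J\<close>, of z]] that by (simp add: mult.commute)
  qed
  have mono: "\<theta> s < \<theta> t" if "s \<in> J" "s < t" for s t
    using growth[OF that] mult_pos_pos[OF pos(2), of "t - s"] that by linarith
  have inj: "inj_on \<theta> J"
    by (rule linorder_inj_onI') (metis mono less_irrefl)
  have cont: "continuous_on J \<theta>"
    by (meson der DERIV_isCont continuous_at_imp_continuous_on)
  have "\<exists>s>t. \<theta> s = \<theta> t + L" if "t \<in> J" for t
  proof -
    \<comment> \<open>At rate at least \<open>\<delta>\<close>, an increase by \<open>L\<close>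
      takes time at most \<open>L / \<delta>\<close>, so the intermediate value theorem applies on
      that time span.\<close>
    have "L \<le> \<theta> (t + L / \<delta>) - \<theta> t"
      using growth[OF that, of "t + L / \<delta>"] pos(2) \<open>0 < L\<close> by simp
    then have "\<exists>s\<ge>t. s \<le> t + L / \<delta> \<and> \<theta> s = \<theta> t + L"
      using that up pos(2) \<open>0 < L\<close>
      by (intro IVT' continuous_on_subset[OF cont]) auto
    then obtain s where "t \<le> s" "\<theta> s = \<theta> t + L" by blast
    then show ?thesis using \<open>0 < L\<close> by (intro exI[of _ s]) (auto simp: less_le)
  qed
  then obtain \<sigma> where \<sigma>: "\<And>t. t \<in> J \<Longrightarrow> t < \<sigma> t" "\<And>t. t \<in> J \<Longrightarrow> \<theta> (\<sigma> t) = \<theta> t + L"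
    by metis
  have \<sigma>J: "\<sigma> t \<in> J" if "t \<in> J" for t using up[OF that] \<sigma>(1)[OF that] by simp
  define \<tau> where "\<tau> = inv_into J \<theta>"
  have \<tau>: "\<tau> (\<theta> t) = t" if "t \<in> J" for t
    unfolding \<tau>_def by (rule inv_into_f_f[OF inj that])
  have der_\<tau>: "(\<tau> has_real_derivative inverse (F t)) (at (\<theta> t))" if "t \<in> J" for t
  proof -
    have "F t \<noteq> 0" using pos(1)[OF that] pos(2) by linarith
    then show ?thesis
      unfolding has_field_derivative_def
      by (intro has_derivative_inverse_strong[OF J(1) that cont \<tau>])
        (use der[OF that] in \<open>auto simp: has_field_derivative_def fun_eq_iff\<close>)
  qed
  \<comment> \<open>This is \<open>\<sigma> t - t\<close> with \<open>\<sigma>\<close> expressed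
    through the inverse \<open>\<tau>\<close>, so that the chain rule applies without prior
    differentiability of \<open>\<sigma>\<close>.\<close>
  have "((\<lambda>t. \<tau> (\<theta> t + L) - t) has_real_derivative 0) (at t)" if t: "t \<in> J" for t
  proof -
    have "F t \<noteq> 0" using pos(1)[OF t] pos(2) by linarith
    have "(\<tau> has_real_derivative inverse (F t)) (at (\<theta> t + L))"
      using der_\<tau>[OF \<sigma>J[OF t]] per[OF \<sigma>J[OF t] t \<sigma>(2)[OF t]] \<sigma>(2)[OF t] by simp
    then have "((\<lambda>t. \<tau> (\<theta> t + L)) has_real_derivative inverse (F t) * F t) (at t)"
      by (rule DERIV_chain2) (use der[OF t] in \<open>auto intro!: derivative_eq_intros\<close>)
    then have "((\<lambda>t. \<tau> (\<theta> t + L) - t) has_real_derivative inverse (F t) * F t - 1) (at t)"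
      by (intro DERIV_diff DERIV_ident)
    then show ?thesis using \<open>F t \<noteq> 0\<close> by simp
  qed
  moreover have "connected J"
    unfolding is_interval_connected_1[symmetric] is_interval_1 using up by blast
  ultimately have "(\<lambda>t. \<tau> (\<theta> t + L) - t) constant_on J"
    by (intro has_field_derivative_0_imp_constant_on J(1))
  then obtain T where "\<And>t. t \<in> J \<Longrightarrow> \<tau> (\<theta> t + L) - t = T"
    unfolding constant_on_def by blast
  then have T: "\<sigma> t = t + T" if "t \<in> J" for t
    using \<tau>[OF \<sigma>J[OF that]] \<sigma>(2)[OF that] that by force
  show ?thesis
  proof (intro exI[of _ T] conjI ballI)
    from J(2) obtain t where "t \<in> J" by blast
    then show "0 < T" using \<sigma>(1) T by fastforce
    show "\<theta> (t + T) = \<theta> t + L" if "t \<in> J" for t using \<sigma>(2)[OF that] T[OF that] by simp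
  qed
qed

text \<open>A nonvanishing curve over a contractible set has a continuous logarithm
  \<open>l\<close>, and the angle is its imaginary part. Near each \<open>t\<close>,
  \<open>l\<close> is a principal logarithm up to a constant, which gives the derivative.\<close>

lemma continuous_argument_with_derivative:
  fixes z :: "real \<Rightarrow> complex"
  assumes J: "open J" "convex J"
    and der: "\<And>t. t \<in> J \<Longrightarrow> (z has_vector_derivative z' t) (at t)"
    and nz: "\<And>t. t \<in> J \<Longrightarrow> z t \<noteq> 0"
  obtains \<theta> where "\<And>t. t \<in> J \<Longrightarrow> z t = of_real (cmod (z t)) * cis (\<theta> t)"
    "\<And>t. t \<in> J \<Longrightarrow> (\<theta> has_real_derivative Im (z' t / z t)) (at t)"
proof -
  have "continuous_on J z"
    by (meson der has_vector_derivative_continuous continuous_at_imp_continuous_on)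
  then obtain l where cont: "continuous_on J l" and l: "\<And>t. t \<in> J \<Longrightarrow> z t = exp (l t)"
    using continuous_logarithm_on_contractible[of J z] convex_imp_contractible[OF J(2)] nz by blast
  have "((\<lambda>t. Im (l t)) has_real_derivative Im (z' t / z t)) (at t)" if t: "t \<in> J" for t
  proof -
    have "isCont l t" using cont J(1) t by (simp add: continuous_on_eq_continuous_at)
    \<comment> \<open>Within distance \<open>pi\<close> the difference \<open>l s - l t\<close>
      stays in the strip on which \<open>Ln\<close> inverts \<open>exp\<close>. Dividing by
      \<open>z t\<close> moves the base value to 1, away from the branch cut.\<close>
    then have "\<forall>\<^sub>F s in at t. dist (l s) (l t) < pi"
      unfolding isCont_def by (rule tendstoD) simp
    then have "\<forall>\<^sub>F s in nhds t. dist (l s) (l t) < pi"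
      by (auto simp: eventually_at_filter elim: eventually_mono)
    moreover have "\<forall>\<^sub>F s in nhds t. s \<in> J" using J(1) t by (rule eventually_nhds_in_open)
    ultimately have ev: "\<forall>\<^sub>F s in nhds t. l s = Ln (z s / z t) + l t"
    proof eventually_elim
      case (elim s)
      have "\<bar>Im (l s - l t)\<bar> < pi"
        using elim(1) abs_Im_le_cmod[of "l s - l t"] by (simp add: dist_norm)
      then have "Ln (exp (l s - l t)) = l s - l t"
        by (intro Ln_exp) auto
      then show ?case using l[OF elim(2)] l[OF t] by (simp add: exp_diff)
    qed
    have "((\<lambda>s. z s / z t) has_vector_derivative z' t / z t) (at t)"
      using der[OF t] by (rule has_vector_derivative_divide)
    moreover have "(Ln has_field_derivative inverse (z t / z t)) (at (z t / z t))"
      using nz[OF t] by (intro has_field_derivative_Ln) auto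
    ultimately have "((Ln \<circ> (\<lambda>s. z s / z t)) has_vector_derivative z' t / z t * inverse (z t / z t)) (at t)"
      by (intro field_vector_diff_chain_at)
    then have "((\<lambda>s. Ln (z s / z t) + l t) has_vector_derivative z' t / z t) (at t)"
      using nz[OF t] by (auto simp: o_def intro!: derivative_eq_intros)
    moreover obtain S where "open S" "t \<in> S" "\<And>s. s \<in> S \<Longrightarrow> l s = Ln (z s / z t) + l t"
      using ev unfolding eventually_nhds by blast
    ultimately have "(l has_vector_derivative z' t / z t) (at t)"
      by (metis (no_types, lifting) has_vector_derivative_transform_within_open)
    then have "((\<lambda>t. Im (l t)) has_vector_derivative Im (z' t / z t)) (at t)"
      by (rule bounded_linear.has_vector_derivative[OF bounded_linear_Im])
    then show ?thesis by (simp add: has_real_derivative_iff_has_vector_derivative)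
  qed
  moreover have "z t = of_real (cmod (z t)) * cis (Im (l t))" if "t \<in> J" for t
    using l[OF that] by (simp add: exp_eq_polar norm_mult)
  ultimately show thesis by (intro that)
qed

text \<open>By the Lagrange identity, a vector orthogonal to \<open>\<omega>\<close> and
  \<open>e\<close> is parallel to their cross product; being orthogonal to it as well, it
  vanishes.\<close>

lemma orthogonal_to_frame_imp_zero:
  fixes w :: "real^3"
  assumes "\<omega> \<noteq> 0" "e \<noteq> 0" "\<omega> \<bullet> e = 0"
    and w: "w \<bullet> \<omega> = 0" "w \<bullet> e = 0" "w \<bullet> cross3 \<omega> e = 0"
  shows "w = 0"
proof -
  have "cross3 w (cross3 \<omega> e) = 0" by (simp add: Lagrange w)
  with w(3) have "w = 0 \<or> cross3 \<omega> e = 0" by (metis norm_and_cross_eq_0)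
  moreover have "cross3 \<omega> e \<noteq> 0" using assms(1-3) norm_and_cross_eq_0 by blast
  ultimately show ?thesis by blast
qed

section \<open>Motion along a level curve on an open half-line or the whole line\<close>

lemma nonzero_if_support_fun_pos:
  assumes "compact U" "U \<noteq> {}" "0 < support_fun U h"
  shows "h \<noteq> 0"
  using inner_maximizer[OF assms(1,2), of 0] assms(3) by auto

text \<open>The geometric core: the angle of \<open>h\<close> around an inner point turns at a rate
  determined by position, so \<open>periodic_rate_imp_constant_period\<close> applies with
  \<open>L = 2 * pi\<close>. The set \<open>J\<close> is open and unbounded to the right, so that a
  full turn after any time can be completed within it.\<close>

lemma extremal_flow_periodic:
  fixes h :: "real \<Rightarrow> real^3"
  assumes U: "strictly_convex_set U" "compact U" "0 \<in> interior U"
    and J: "open J" "J \<noteq> {}" and up: "\<And>s t. t \<in> J \<Longrightarrow> t \<le> s \<Longrightarrow> s \<in> J"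
    and der: "\<And>t. t \<in> J \<Longrightarrow> (h has_vector_derivative cross3 \<omega> (maximizer U (h t))) (at t)"
    and lev: "\<And>t. t \<in> J \<Longrightarrow> support_fun U (h t) = c" and "0 < c"
  shows "\<exists>T>0. \<forall>t\<in>J. maximizer U (h (t + T)) = maximizer U (h t)"
proof -
  define g where "g = maximizer U"
  have Une: "U \<noteq> {}" using U(3) interior_subset by blast
  have gU: "g q \<in> U" and gq: "g q \<bullet> q = support_fun U q" for q
    unfolding g_def by (fact maximizer[OF U(2) Une])+
  have le: "g q \<bullet> q' \<le> support_fun U q'" for q q'
    by (rule inner_le_support_fun[OF U(2) gU])
  have nz: "h t \<noteq> 0" if "t \<in> J" for t
    by (rule nonzero_if_support_fun_pos[OF U(2) Une]) (simp add: lev that \<open>0 < c\<close>)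
  have intJ: "is_interval J" unfolding is_interval_1 using up by blast
  then have conv: "convex J" "connected J"
    by (simp_all add: is_interval_convex_1[symmetric] is_interval_connected_1[symmetric])
  have der: "(h has_vector_derivative cross3 \<omega> (g (h t))) (at t)" if "t \<in> J" for t
    using der[OF that] by (simp add: g_def)
  obtain t0 where t0: "t0 \<in> J" using J(2) by blast
  have "((\<lambda>t. \<omega> \<bullet> h t) has_real_derivative 0) (at t)" if "t \<in> J" for t
    using bounded_linear.has_vector_derivative[OF bounded_linear_inner_right der[OF that], of \<omega>]
    by (simp add: dot_cross_self has_real_derivative_iff_has_vector_derivative)
  then have "(\<lambda>t. \<omega> \<bullet> h t) constant_on J"
    by (intro has_field_derivative_0_imp_constant_on conv J(1))
  then have plane: "\<omega> \<bullet> h t = \<omega> \<bullet> h t0" if "t \<in> J" for t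
    using that t0 unfolding constant_on_def by metis
  \<comment> \<open>The velocity of \<open>h\<close> at \<open>t0\<close>; it vanishes exactly when
    \<open>\<omega>\<close> and the control at \<open>t0\<close> are linearly dependent.\<close>
  define e where "e = cross3 \<omega> (g (h t0))"
  show ?thesis
  proof (cases "e = 0")
    case True
    \<comment> \<open>The plane supports the level set at \<open>h t0\<close>, so the motion stays in one face.\<close>
    have const: "g (h t) = g (h t0)" if t: "t \<in> J" for t
    proof (cases "\<omega> = 0")
      case True
      then have "(h has_vector_derivative 0) (at t within J)" if "t \<in> J" for t
        using der[OF that] has_vector_derivative_at_within by fastforce
      then obtain k where "\<And>t. t \<in> J \<Longrightarrow> h t = k"
        using has_vector_derivative_zero_constant[OF conv(1)] by metis
      then show ?thesis using t t0 by simp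
    next
      case False
      \<comment> \<open>The control at \<open>t0\<close> is a multiple of \<open>\<omega>\<close>,
        so its pairing with \<open>h t\<close> is constant because
        \<open>\<omega> \<bullet> h\<close> is. That constant is \<open>c\<close>, hence the same
        control is the maximizer at every \<open>h t\<close>.\<close>
      have "(\<omega> \<bullet> \<omega>) *\<^sub>R g (h t0) = (\<omega> \<bullet> g (h t0)) *\<^sub>R \<omega>"
        using Lagrange[of \<omega> \<omega> "g (h t0)"] True by (simp add: e_def)
      then have "(\<omega> \<bullet> \<omega>) * (g (h t0) \<bullet> h t) = (\<omega> \<bullet> \<omega>) * (g (h t0) \<bullet> h t0)"
        using plane[OF t] by (metis inner_scaleR_left)
      then have "g (h t0) \<bullet> h t = support_fun U (h t)"
        using False gq[of "h t0"] lev[OF t] lev[OF t0] by simp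
      then show ?thesis
        using maximizer_eqI[OF U(1,2) nz[OF t] gU] by (simp add: g_def)
    qed
    show ?thesis
    proof (intro exI[of _ 1] conjI ballI)
      fix t assume "t \<in> J"
      then show "maximizer U (h (t + 1)) = maximizer U (h t)"
        using const[of t] const[of "t + 1"] up[of t "t + 1"] by (simp add: g_def)
    qed simp
  next
    case False
    \<comment> \<open>Within the plane, \<open>y\<close> is a descent direction of the support function at \<open>h t0\<close>; it
      leads to a point \<open>p\<close> inside the level curve, and the motion is described by its angle
      around \<open>p\<close>.\<close>
    define y where "y = cross3 \<omega> e"
    define a where "a = norm \<omega>"
    have "\<omega> \<noteq> 0" using False by (auto simp: e_def)
    then have "0 < a" by (simp add: a_def)
    have orth: "\<omega> \<bullet> e = 0" "\<omega> \<bullet> y = 0" "e \<bullet> y = 0"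
      by (simp_all add: e_def y_def dot_cross_self)
    have yy: "y \<bullet> y = a\<^sup>2 * (e \<bullet> e)"
      by (simp add: y_def dot_cross orth a_def power2_norm_eq_inner inner_commute[of e \<omega>])
    \<comment> \<open>\<open>eg\<close> and \<open>yg\<close> give the components of a velocity
      \<open>cross3 \<omega> v\<close> along the two axes \<open>e\<close> and \<open>y\<close> of
      the plane.\<close>
    have eg: "e \<bullet> cross3 \<omega> v = - (y \<bullet> v)" for v
      unfolding y_def by (metis cross_skew cross_triple inner_commute inner_minus_left)
    have yg: "y \<bullet> cross3 \<omega> v = a\<^sup>2 * (e \<bullet> v)" for v
      by (simp add: y_def dot_cross orth a_def power2_norm_eq_inner inner_commute[of e \<omega>])
    have frame: "w = 0" if "w \<bullet> \<omega> = 0" "w \<bullet> e = 0" "w \<bullet> y = 0" for w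
      using orthogonal_to_frame_imp_zero[OF \<open>\<omega> \<noteq> 0\<close> False orth(1)] that by (simp add: y_def)
    have "g (h t0) \<bullet> y = - (e \<bullet> e)"
      using eg[of "g (h t0)"] by (simp add: e_def[symmetric] inner_commute)
    then have neg: "g (h t0) \<bullet> y < 0" using False by simp
    \<comment> \<open>The descent inequality is needed at the displaced point, since the estimate of
      the support function at \<open>p\<close> uses the maximizer there. Continuity of
      \<open>g\<close> carries it over for small \<open>s\<close>.\<close>
    have "isCont g (h t0)"
      using continuous_on_maximizer[OF U(1,2) Une] nz[OF t0]
      by (simp add: g_def continuous_on_eq_continuous_at[OF open_Compl[OF closed_singleton]])
    moreover have "((\<lambda>s. h t0 + s *\<^sub>R y) \<longlongrightarrow> h t0) (at_right 0)"
      by (auto intro!: tendsto_eq_intros)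
    ultimately have "((\<lambda>s. g (h t0 + s *\<^sub>R y) \<bullet> y) \<longlongrightarrow> g (h t0) \<bullet> y) (at_right 0)"
      by (intro tendsto_inner tendsto_const isCont_tendsto_compose[of _ g])
    then have "\<forall>\<^sub>F s in at_right 0. g (h t0 + s *\<^sub>R y) \<bullet> y < 0"
      using neg by (rule order_tendstoD(2))
    then have "\<forall>\<^sub>F s in at_right 0. 0 < s \<and> g (h t0 + s *\<^sub>R y) \<bullet> y < 0"
      by (intro eventually_conj eventually_at_right_less)
    then have "\<exists>s. 0 < s \<and> g (h t0 + s *\<^sub>R y) \<bullet> y < 0"
      by (rule eventually_happens'[OF trivial_limit_at_right_real])
    then obtain s where s: "0 < s" "g (h t0 + s *\<^sub>R y) \<bullet> y < 0"
      by blast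
    define p where "p = h t0 + s *\<^sub>R y"
    have "support_fun U p = g p \<bullet> h t0 + s * (g p \<bullet> y)"
      unfolding gq[symmetric] p_def by (simp add: inner_add_right)
    also have "\<dots> < g p \<bullet> h t0" using s by (simp add: p_def mult_pos_neg)
    also have "\<dots> \<le> c" using le lev[OF t0] by metis
    finally have Hp: "support_fun U p < c" .
    define x where "x = (\<lambda>t. h t - p)"
    have hx: "h t = p + x t" for t by (simp add: x_def)
    have x\<omega>: "x t \<bullet> \<omega> = 0" if "t \<in> J" for t
      using plane[OF that] orth(2)
      by (simp add: x_def p_def inner_diff_right inner_add_right inner_commute[of _ \<omega>])
    \<comment> \<open>Complex coordinate in the plane with origin \<open>p\<close> and axes
      \<open>e\<close> and \<open>y\<close>. As \<open>norm y\<close> equals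
      \<open>a * norm e\<close>, dividing by \<open>a\<close> gives both axes the same
      scale.\<close>
    define z where "z = (\<lambda>t. Complex (e \<bullet> x t) (y \<bullet> x t / a))"
    define z' where "z' = (\<lambda>t. Complex (- (y \<bullet> g (h t))) (a * (e \<bullet> g (h t))))"
    have znz: "z t \<noteq> 0" if "t \<in> J" for t
    proof
      assume "z t = 0"
      then have "x t = 0"
        using \<open>0 < a\<close> by (intro frame x\<omega> that) (auto simp: z_def complex_eq_iff inner_commute)
      then show False using Hp lev[OF that] by (simp add: hx)
    qed
    have derz: "(z has_vector_derivative z' t) (at t)" if t: "t \<in> J" for t
    proof -
      have "(x has_vector_derivative cross3 \<omega> (g (h t))) (at t)"
        unfolding x_def using der[OF t] by (auto intro!: derivative_eq_intros)
      then have e: "((\<lambda>t. e \<bullet> x t) has_real_derivative - (y \<bullet> g (h t))) (at t)"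
        and y: "((\<lambda>t. y \<bullet> x t) has_real_derivative a\<^sup>2 * (e \<bullet> g (h t))) (at t)"
        using bounded_linear.has_vector_derivative[OF bounded_linear_inner_right, of x _ _ e]
          bounded_linear.has_vector_derivative[OF bounded_linear_inner_right, of x _ _ y]
        by (simp_all add: eg[symmetric] yg[symmetric] has_real_derivative_iff_has_vector_derivative)
      have "((\<lambda>t. y \<bullet> x t / a) has_real_derivative a * (e \<bullet> g (h t))) (at t)"
        using DERIV_cdivide[OF y, of a] \<open>0 < a\<close> by (simp add: power2_eq_square)
      then show ?thesis
        using e unfolding z_def z'_def
        by (simp add: has_vector_derivative_complex_iff has_real_derivative_iff_has_vector_derivative)
    qed
    \<comment> \<open>The angular velocity, rewritten so that it depends on \<open>t\<close> only
      through \<open>h t\<close>. Its numerator contains \<open>x t \<bullet> g (h t)\<close>, which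
      convexity bounds from below.\<close>
    define F where "F = (\<lambda>t. a * (e \<bullet> e) * (x t \<bullet> g (h t)) / (cmod (z t))\<^sup>2)"
    have ImF: "Im (z' t / z t) = F t" if t: "t \<in> J" for t
    proof -
      \<comment> \<open>Expansion of \<open>x t\<close> in the orthogonal axes, multiplied by
        \<open>e \<bullet> e\<close>; the divisor \<open>a\<^sup>2\<close> comes from
        \<open>yy\<close>.\<close>
      have "(e \<bullet> e) *\<^sub>R x t - (e \<bullet> x t) *\<^sub>R e - (y \<bullet> x t / a\<^sup>2) *\<^sub>R y = 0"
        using x\<omega>[OF t] orth yy \<open>0 < a\<close>
        by (intro frame) (simp_all add: inner_diff_right inner_commute)
      then have "((e \<bullet> e) *\<^sub>R x t - (e \<bullet> x t) *\<^sub>R e - (y \<bullet> x t / a\<^sup>2) *\<^sub>R y) \<bullet> g (h t) = 0"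
        by simp
      then have "(e \<bullet> e) * (x t \<bullet> g (h t))
          = (e \<bullet> x t) * (e \<bullet> g (h t)) + y \<bullet> x t / a\<^sup>2 * (y \<bullet> g (h t))"
        by (simp add: inner_diff_left)
      then have "a * (e \<bullet> e) * (x t \<bullet> g (h t))
          = a * ((e \<bullet> x t) * (e \<bullet> g (h t)) + y \<bullet> x t / a\<^sup>2 * (y \<bullet> g (h t)))"
        by simp
      also have "\<dots> = Im (z' t) * Re (z t) - Re (z' t) * Im (z t)"
        using \<open>0 < a\<close> by (simp add: z_def z'_def field_simps power2_eq_square)
      finally show ?thesis by (simp add: F_def Im_divide cmod_power2)
    qed
    obtain \<theta> where \<theta>: "\<And>t. t \<in> J \<Longrightarrow> z t = of_real (cmod (z t)) * cis (\<theta> t)"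
      and der\<theta>: "\<And>t. t \<in> J \<Longrightarrow> (\<theta> has_real_derivative F t) (at t)"
      using continuous_argument_with_derivative[OF J(1) conv(1) derz znz] ImF by metis
    \<comment> \<open>Angles differing by a full turn put both points on one ray from
      \<open>p\<close>, and such a ray meets the level set only once.\<close>
    have same: "h s = h t" if s: "s \<in> J" and t: "t \<in> J" and "\<theta> s = \<theta> t + 2 * pi" for s t
    proof -
      define k where "k = cmod (z s) / cmod (z t)"
      have "0 < k" using znz[OF s] znz[OF t] by (simp add: k_def)
      have "cis (\<theta> s) = cis (\<theta> t)" using that(3) by (simp add: complex_eq_iff)
      then have "z s = of_real k * z t"
        using \<theta>[OF s] \<theta>[OF t] znz[OF t]
        by (metis (no_types, lifting) k_def mult.assoc nonzero_divide_mult_cancel_right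
          norm_eq_zero of_real_mult times_divide_eq_left nonzero_mult_div_cancel_right)
      then have "e \<bullet> x s = k * (e \<bullet> x t)" "y \<bullet> x s = k * (y \<bullet> x t)"
        using \<open>0 < a\<close> by (auto simp: z_def complex_eq_iff)
      then have "x s - k *\<^sub>R x t = 0"
        using x\<omega>[OF s] x\<omega>[OF t]
        by (intro frame) (simp_all add: inner_diff_right inner_commute)
      then have xs: "x s = k *\<^sub>R x t" by simp
      then have "k = 1"
        using support_fun_level_ray_unique[OF U(2) Une Hp, of "x t" k] lev[OF s] lev[OF t] \<open>0 < k\<close>
        by (simp add: hx)
      then show "h s = h t" using xs by (simp add: hx)
    qed
    obtain r where r: "0 < r" "\<And>q. r * norm q \<le> support_fun U q"
      using support_fun_lower_bound[OF U(2,3)] by blast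
    \<comment> \<open>The level set lies in the ball of radius \<open>c / r\<close>, so
      \<open>R\<close> bounds the distance to \<open>p\<close>; by Cauchy-Schwarz in each
      coordinate, \<open>M\<close> bounds the squared modulus of \<open>z\<close>.\<close>
    define R where "R = c / r + norm p"
    define M where "M = (norm e * R)\<^sup>2 + (norm y * R / a)\<^sup>2"
    have zM: "(cmod (z t))\<^sup>2 \<le> M" if t: "t \<in> J" for t
    proof -
      have "norm (h t) \<le> c / r" using r(2)[of "h t"] r(1) lev[OF t] by (simp add: field_simps)
      then have xR: "norm (x t) \<le> R"
        unfolding x_def R_def using norm_triangle_ineq4[of "h t" p] by linarith
      have sq: "(v \<bullet> x t)\<^sup>2 \<le> (norm v * R)\<^sup>2" for v
      proof -
        have "\<bar>v \<bullet> x t\<bar> \<le> norm v * R"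
          using Cauchy_Schwarz_ineq2[of v "x t"] mult_left_mono[OF xR norm_ge_zero[of v]] by linarith
        then show ?thesis by (rule power_mono[of "\<bar>v \<bullet> x t\<bar>" _ 2, simplified power2_abs]) simp
      qed
      then have "(y \<bullet> x t / a)\<^sup>2 \<le> (norm y * R / a)\<^sup>2"
        by (simp add: power_divide divide_right_mono)
      with sq[of e] have "(e \<bullet> x t)\<^sup>2 + (y \<bullet> x t / a)\<^sup>2 \<le> M"
        unfolding M_def by (rule add_mono)
      then show ?thesis unfolding cmod_power2 z_def by simp
    qed
    have "0 < M" by (rule less_le_trans[OF _ zM[OF t0]]) (use znz[OF t0] in simp)
    define \<delta> where "\<delta> = a * (e \<bullet> e) * (c - support_fun U p) / M"
    have "0 < \<delta>" using \<open>0 < a\<close> \<open>0 < M\<close> False Hp by (simp add: \<delta>_def)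
    have F\<delta>: "\<delta> \<le> F t" if t: "t \<in> J" for t
    proof -
      \<comment> \<open>The first term is \<open>c\<close>, the second at most the support function
        at \<open>p\<close>: the tangent at \<open>h t\<close> stays a definite distance away from
        \<open>p\<close>.\<close>
      have "x t \<bullet> g (h t) = g (h t) \<bullet> h t - g (h t) \<bullet> p"
        unfolding x_def inner_diff_left by (simp add: inner_commute)
      then have "c - support_fun U p \<le> x t \<bullet> g (h t)"
        using le[of "h t" p] gq[of "h t"] lev[OF t] by simp
      then have "a * (e \<bullet> e) * (c - support_fun U p) \<le> a * (e \<bullet> e) * (x t \<bullet> g (h t))"
        using \<open>0 < a\<close> by (intro mult_left_mono) auto
      moreover have "0 \<le> a * (e \<bullet> e) * (c - support_fun U p)" using \<open>0 < a\<close> Hp by simp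
      ultimately show ?thesis
        unfolding \<delta>_def F_def by (intro frac_le zM[OF t]) (use znz[OF t] in auto)
    qed
    have FF: "F s = F t" if "s \<in> J" "t \<in> J" "\<theta> s = \<theta> t + 2 * pi" for s t
      using same[OF that] by (simp add: F_def z_def x_def)
    have "\<exists>T>0. \<forall>t\<in>J. \<theta> (t + T) = \<theta> t + 2 * pi"
    proof (rule periodic_rate_imp_constant_period)
      show "\<delta> \<le> F t" if "t \<in> J" for t using F\<delta>[OF that] .
    qed (fact J up der\<theta> \<open>0 < \<delta>\<close> FF | simp)+
    then obtain T where T: "0 < T" "\<And>t. t \<in> J \<Longrightarrow> \<theta> (t + T) = \<theta> t + 2 * pi"
      by blast
    show ?thesis
    proof (intro exI[of _ T] conjI ballI T(1))
      fix t assume "t \<in> J"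
      then have "h (t + T) = h t" using T up[of t "t + T"] by (intro same) auto
      then show "maximizer U (h (t + T)) = maximizer U (h t)" by simp
    qed
  qed
qed

section \<open>Periodic extension of controls and passage to arbitrary intervals\<close>

lemma periodic_control_on_bounded:
  assumes "I \<subseteq> {a..b}"
  shows "periodic_control_on I v"
proof (cases "a \<le> b")
  case True
  \<comment> \<open>The summand 1 keeps the period positive when \<open>a = b\<close> and makes
    \<open>frac\<close> act as the identity up to and including the endpoint
    \<open>b\<close>.\<close>
  define T where "T = b - a + 1"
  have "0 < T" using True by (simp add: T_def)
  let ?w = "\<lambda>t. v (a + T * frac ((t - a) / T))"
  have "periodic_fun_simple ?w T"
  proof
    fix t
    have "(t + T - a) / T = (t - a) / T + 1" using \<open>0 < T\<close> by (simp add: field_simps)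
    then show "?w (t + T) = ?w t" by (simp add: frac_1_eq)
  qed
  moreover have "v t = ?w t" if "t \<in> I" for t
  proof -
    have "a \<le> t" "t \<le> b" using that assms by auto
    then have "frac ((t - a) / T) = (t - a) / T"
      using \<open>0 < T\<close> by (subst frac_eq) (auto simp: T_def)
    then show ?thesis using \<open>0 < T\<close> by simp
  qed
  ultimately show ?thesis unfolding periodic_control_on_def using \<open>0 < T\<close> by blast
next
  case False
  then have "I = {}" using assms by auto
  moreover have "periodic_fun_simple v' 1" if "v' = (\<lambda>_. undefined)" for v' :: "real \<Rightarrow> 'a"
    by standard (simp add: that)
  ultimately show ?thesis unfolding periodic_control_on_def
    by (metis empty_iff zero_less_one)
qed

text \<open>The extension is read off from the values on the fundamental domain from 0 to
  \<open>T\<close>, which lies in \<open>I\<close>.\<close>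

lemma periodic_control_on_ray:
  assumes "0 \<in> I" and up: "\<And>s t. t \<in> I \<Longrightarrow> t \<le> s \<Longrightarrow> s \<in> I"
    and "0 < T" and per: "\<And>t. t \<in> I \<Longrightarrow> v (t + T) = v t"
  shows "periodic_control_on I v"
proof -
  have shift: "v (t + real n * T) = v t" if "t \<in> I" for t n
  proof (induction n)
    case (Suc n)
    have "t + real n * T \<in> I" using up[OF that] \<open>0 < T\<close> by simp
    from per[OF this] Suc show ?case by (simp add: algebra_simps)
  qed simp
  let ?w = "\<lambda>t. v (T * frac (t / T))"
  have "periodic_fun_simple ?w T"
  proof
    fix t
    have "(t + T) / T = t / T + 1" using \<open>0 < T\<close> by (simp add: field_simps)
    then show "?w (t + T) = ?w t" by (simp add: frac_1_eq)
  qed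
  moreover have "v t = ?w t" if "t \<in> I" for t
  proof -
    let ?f = "T * frac (t / T)"
    have f: "?f = t - of_int \<lfloor>t / T\<rfloor> * T"
      using \<open>0 < T\<close> by (simp add: frac_def right_diff_distrib)
    have "?f \<in> I" using up[OF \<open>0 \<in> I\<close>] \<open>0 < T\<close> by simp
    show ?thesis
    \<comment> \<open>Only forward shifts are certain to stay in \<open>I\<close>: a nonnegative
      quotient shifts the representative up to \<open>t\<close>, a negative one shifts
      \<open>t\<close> up to the representative.\<close>
    proof (cases "0 \<le> \<lfloor>t / T\<rfloor>")
      case True
      then have "t = ?f + real (nat \<lfloor>t / T\<rfloor>) * T" using f by simp
      then show ?thesis using shift[OF \<open>?f \<in> I\<close>] by metis
    next
      case False
      then have "?f = t + real (nat (- \<lfloor>t / T\<rfloor>)) * T" using f by simp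
      then show ?thesis using shift[OF that] by metis
    qed
  qed
  ultimately show ?thesis unfolding periodic_control_on_def using \<open>0 < T\<close> by blast
qed

lemma periodic_control_on_reflect:
  assumes "periodic_control_on (uminus ` I) (\<lambda>t. v (- t))"
  shows "periodic_control_on I v"
proof -
  from assms obtain w T where w: "0 < T" "periodic_fun_simple w T"
      "\<forall>t\<in>uminus ` I. v (- t) = w t"
    unfolding periodic_control_on_def by blast
  interpret periodic_fun_simple w T by fact
  have "periodic_fun_simple (\<lambda>t. w (- t)) T"
    by standard (use minus_1 in simp)
  moreover have "v t = w (- t)" if "t \<in> I" for t using w(3) that by force
  ultimately show ?thesis unfolding periodic_control_on_def using w(1) by blast
qed

text \<open>The period is found on an open set and then extended by one-sided continuity to a
  possible left endpoint of \<open>I\<close>.\<close>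

lemma extremal_flow_periodic_on_ray:
  fixes h :: "real \<Rightarrow> real^3"
  assumes U: "strictly_convex_set U" "compact U" "0 \<in> interior U"
    and I: "0 \<in> I" and up: "\<And>s t. t \<in> I \<Longrightarrow> t \<le> s \<Longrightarrow> s \<in> I"
    and cont: "continuous_on I (\<lambda>t. maximizer U (h t))"
    and der: "\<And>t. t \<in> interior I \<Longrightarrow>
      (h has_vector_derivative cross3 \<omega> (maximizer U (h t))) (at t)"
    and lev: "\<And>t. t \<in> I \<Longrightarrow> support_fun U (h t) = c" and "0 < c"
  shows "periodic_control_on I (\<lambda>t. maximizer U (h t))"
proof -
  let ?v = "\<lambda>t. maximizer U (h t)"
  \<comment> \<open>This is \<open>I\<close> without its least element, if there is one.\<close>
  define J where "J = (\<Union>s\<in>I. {s<..})"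
  have J: "open J" "J \<noteq> {}" using I by (auto simp: J_def intro: gt_ex)
  have upJ: "s \<in> J" if "t \<in> J" "t \<le> s" for s t
    using that unfolding J_def by (auto intro: less_le_trans)
  have JI: "J \<subseteq> I" using up by (force simp: J_def)
  then have JJ: "J \<subseteq> interior I" using J(1) by (rule interior_maximal)
  have "\<exists>T>0. \<forall>t\<in>J. ?v (t + T) = ?v t"
    by (rule extremal_flow_periodic[OF U J, where \<omega> = \<omega> and c = c])
      (use upJ der lev \<open>0 < c\<close> JI JJ in blast)+
  then obtain T where T: "0 < T" "\<And>t. t \<in> J \<Longrightarrow> ?v (t + T) = ?v t"
    by blast
  \<comment> \<open>The control and its translate by \<open>T\<close> agree to the right of
    \<open>t\<close>, so their right limits, which are their values at \<open>t\<close>, agree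
    too.\<close>
  have per: "?v (t + T) = ?v t" if t: "t \<in> I" for t
  proof -
    have right: "{t<..} \<subseteq> I" "{t<..} \<subseteq> J" using up[OF t] t by (auto simp: J_def)
    have "(?v \<longlongrightarrow> ?v t) (at_right t)"
      using cont t right(1) unfolding continuous_on_def by (meson tendsto_within_subset)
    moreover have "continuous_on I (\<lambda>s. ?v (s + T))"
      by (rule continuous_on_compose2[OF cont]) (use up T(1) in \<open>auto intro!: continuous_intros\<close>)
    then have "((\<lambda>s. ?v (s + T)) \<longlongrightarrow> ?v (t + T)) (at_right t)"
      using t right(1) unfolding continuous_on_def by (meson tendsto_within_subset)
    moreover have ev: "\<forall>\<^sub>F s in at_right t. ?v (s + T) = ?v s"
      unfolding eventually_at_filter using T(2) right(2) by (intro always_eventually) auto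
    ultimately have "(?v \<longlongrightarrow> ?v (t + T)) (at_right t)" "(?v \<longlongrightarrow> ?v t) (at_right t)"
      using tendsto_cong[OF ev] by simp_all
    then show ?thesis by (rule tendsto_unique[OF trivial_limit_at_right_real])
  qed
  show ?thesis by (rule periodic_control_on_ray[where T = T]) (fact I up T(1) per)+
qed

lemma extremal_flow_periodic_on_interval:
  fixes h :: "real \<Rightarrow> real^3"
  assumes U: "strictly_convex_set U" "compact U" "0 \<in> interior U"
    and I: "is_interval I" "0 \<in> I"
    and cont: "continuous_on I (\<lambda>t. maximizer U (h t))"
    and der: "\<And>t. t \<in> interior I \<Longrightarrow>
      (h has_vector_derivative cross3 \<omega> (maximizer U (h t))) (at t)"
    and lev: "\<And>t. t \<in> I \<Longrightarrow> support_fun U (h t) = c" and "0 < c"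
  shows "periodic_control_on I (\<lambda>t. maximizer U (h t))"
proof -
  \<comment> \<open>Bounded intervals admit a direct periodic extension; only an unbounded side
    calls on the flow, and one unbounded below is reached by time reversal.\<close>
  consider "bdd_above I" "bdd_below I" | "\<not> bdd_above I" | "\<not> bdd_below I" by metis
  then show ?thesis
  proof cases
    case 1
    then obtain a b where "I \<subseteq> {a..b}" unfolding bdd_above_def bdd_below_def by fastforce
    then show ?thesis by (rule periodic_control_on_bounded)
  next
    case 2
    have "s \<in> I" if "t \<in> I" "t \<le> s" for s t
    proof -
      obtain b where "b \<in> I" "s \<le> b"
        using 2 unfolding bdd_above_def by (meson linear)
      then show ?thesis using I(1) that unfolding is_interval_1 by blast
    qed
    then show ?thesis by (rule extremal_flow_periodic_on_ray[OF U I(2) _ cont der lev \<open>0 < c\<close>])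
  next
    case 3
    \<comment> \<open>The reversed curve solves the same equation with \<open>- \<omega>\<close>, so
      the result for rays applies to it.\<close>
    have "periodic_control_on (uminus ` I) (\<lambda>t. maximizer U ((\<lambda>t. h (- t)) t))"
    proof (rule extremal_flow_periodic_on_ray[OF U, where \<omega> = "- \<omega>" and c = c])
      show "0 \<in> uminus ` I" using I(2) by force
      show "s \<in> uminus ` I" if t: "t \<in> uminus ` I" "t \<le> s" for s t
      proof -
        obtain a where "a \<in> I" "a \<le> - s"
          using 3 unfolding bdd_below_def by (meson linear)
        moreover have "- t \<in> I" using t(1) by force
        ultimately have "- s \<in> I" using I(1) t(2) unfolding is_interval_1
          by (meson neg_le_iff_le)
        then show ?thesis by force
      qed
      show "continuous_on (uminus ` I) (\<lambda>t. maximizer U (h (- t)))"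
        by (rule continuous_on_compose2[OF cont]) (auto intro!: continuous_intros)
      show "((\<lambda>t. h (- t)) has_vector_derivative cross3 (- \<omega>) (maximizer U (h (- t)))) (at t)"
        if "t \<in> interior (uminus ` I)" for t
      proof -
        have "- t \<in> interior I" using that by (auto simp: interior_negations)
        from der[OF this] have "((h \<circ> uminus) has_vector_derivative
            (-1) *\<^sub>R cross3 \<omega> (maximizer U (h (- t)))) (at t)"
          by (intro vector_diff_chain_at) (auto intro!: derivative_eq_intros)
        then show ?thesis by (simp add: o_def)
      qed
      show "support_fun U (h (- t)) = c" if "t \<in> uminus ` I" for t
        using that lev by auto
    qed fact
    then show ?thesis by (rule periodic_control_on_reflect)
  qed
qed

section \<open>Normal extremal controls\<close>

text \<open>A convergent sequence together with its limit is compact, so it lies between two of its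
  own points. The Lipschitz bound on that compact subinterval gives convergence of the
  values.\<close>

lemma continuous_on_interval_if_locally_lipschitz:
  fixes f :: "real \<Rightarrow> 'b::metric_space"
  assumes I: "is_interval I"
    and lip: "\<And>a b. {a..b} \<subseteq> I \<Longrightarrow> \<exists>C. C-lipschitz_on {a..b} f"
  shows "continuous_on I f"
  unfolding continuous_on_sequentially
proof (intro allI ballI impI, elim conjE)
  fix x t assume t: "t \<in> I" and x: "\<forall>n. x n \<in> I" "x \<longlonglongrightarrow> t"
  let ?K = "insert t (range x)"
  have K: "compact ?K" "?K \<noteq> {}" using compact_sequence_with_limit[OF x(2)] by auto
  obtain a b where a: "a \<in> ?K" "\<And>y. y \<in> ?K \<Longrightarrow> a \<le> y" and b: "b \<in> ?K" "\<And>y. y \<in> ?K \<Longrightarrow> y \<le> b"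
    using compact_attains_inf[OF K] compact_attains_sup[OF K] by metis
  have "a \<in> I" "b \<in> I" using a(1) b(1) t x(1) by auto
  then have "{a..b} \<subseteq> I" using I[unfolded is_interval_1] by fastforce
  then obtain C where "C-lipschitz_on {a..b} f" using lip by blast
  then have "continuous_on {a..b} f" by (rule lipschitz_on_continuous_on)
  moreover have "t \<in> {a..b}" "\<forall>n. x n \<in> {a..b}" using a(2) b(2) by auto
  ultimately show "(f \<circ> x) \<longlonglongrightarrow> f t"
    using x(2) unfolding continuous_on_sequentially by blast
qed

lemma lipschitz_on_bounded_bilinear:
  assumes "bounded_bilinear p" and f: "C-lipschitz_on S f" "bounded (f ` S)"
    and g: "D-lipschitz_on S g" "bounded (g ` S)"
  shows "\<exists>E. E-lipschitz_on S (\<lambda>x. p (f x) (g x))"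
proof -
  interpret bounded_bilinear p by fact
  obtain K where K: "0 \<le> K" "\<And>a b. norm (p a b) \<le> norm a * norm b * K"
    using nonneg_bounded by blast
  obtain A where A: "0 < A" "\<And>x. x \<in> S \<Longrightarrow> norm (f x) \<le> A"
    using f(2) unfolding bounded_pos by auto
  obtain B where B: "0 < B" "\<And>x. x \<in> S \<Longrightarrow> norm (g x) \<le> B"
    using g(2) unfolding bounded_pos by auto
  have C: "0 \<le> C" and D: "0 \<le> D" using f(1) g(1) lipschitz_on_nonneg by blast+
  have "((C * B + A * D) * K)-lipschitz_on S (\<lambda>x. p (f x) (g x))"
  proof (rule lipschitz_onI)
    fix x y assume xy: "x \<in> S" "y \<in> S"
    have "p (f x) (g x) - p (f y) (g y) = p (f x - f y) (g x) + p (f y) (g x - g y)"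
      by (simp add: diff_left diff_right)
    then have "dist (p (f x) (g x)) (p (f y) (g y))
        \<le> norm (f x - f y) * norm (g x) * K + norm (f y) * norm (g x - g y) * K"
      unfolding dist_norm using K(2) by (metis norm_triangle_mono)
    also have "\<dots> \<le> (C * dist x y) * B * K + A * (D * dist x y) * K"
      using xy lipschitz_onD[OF f(1) xy] lipschitz_onD[OF g(1) xy] A B C D K(1)
      by (intro add_mono mult_mono mult_nonneg_nonneg) (auto simp: dist_norm)
    finally show "dist (p (f x) (g x)) (p (f y) (g y)) \<le> (C * B + A * D) * K * dist x y"
      by (simp add: algebra_simps)
  qed (use A B C D K(1) in simp)
  then show ?thesis by blast
qed

context carnot_algebra_step2_gen3
begin

lemma hamfun_eq: "hamfun br v lam = blinfun_apply (snd lam) (v + (1/2) *\<^sub>R br (fst lam) v)"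
  by (simp add: hamfun_def left_field_eq)

text \<open>Brackets are central, so the left-invariant field of a bracket is constant in these
  coordinates and the base point drops out.\<close>

lemma hamfun_br: "hamfun br (br x y) lam = blinfun_apply (snd lam) (br x y)"
  by (simp add: hamfun_eq br_br)

lemma hamfun_br_anti: "hamfun br (br x y) lam = - hamfun br (br y x) lam"
  unfolding hamfun_br by (subst br_anti) (simp add: blinfun.minus_right)

text \<open>The Hamiltonian pairs the covector with a field affine in the base point; both factors
  are Lipschitz and bounded on a compact interval.\<close>

lemma lipschitz_on_hamfun:
  assumes lam: "C-lipschitz_on {a..b} lam"
  shows "\<exists>E. E-lipschitz_on {a..b::real} (\<lambda>t. hamfun br v (lam t))"
proof -
  have lin: "bounded_linear (\<lambda>q. (1/2) *\<^sub>R br q v)"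
    using bilinear_br
    by (intro linear_conv_bounded_linear[THEN iffD1] linear_compose_scale_right)
      (simp add: bilinear_def)
  have "C-lipschitz_on {a..b} (\<lambda>t. fst (lam t))" "C-lipschitz_on {a..b} (\<lambda>t. snd (lam t))"
    using lam unfolding lipschitz_on_def
    by (meson dist_fst_le dist_snd_le order_trans)+
  moreover obtain K where "K-lipschitz_on UNIV (\<lambda>q. (1/2) *\<^sub>R br q v)"
    using bounded_linear.lipschitz_boundE[OF lin] by blast
  ultimately have f: "C-lipschitz_on {a..b} (\<lambda>t. snd (lam t))"
    and "(K * C)-lipschitz_on {a..b} (\<lambda>t. (1/2) *\<^sub>R br (fst (lam t)) v)"
    using lipschitz_on_compose2[of C "{a..b}" "\<lambda>t. fst (lam t)" K "\<lambda>q. (1/2) *\<^sub>R br q v"]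
      lipschitz_on_subset[OF _ subset_UNIV, of K] by blast+
  then have g: "(0 + K * C)-lipschitz_on {a..b} (\<lambda>t. v + (1/2) *\<^sub>R br (fst (lam t)) v)"
    by (intro lipschitz_on_add lipschitz_on_constant)
  have "\<exists>E. E-lipschitz_on {a..b} (\<lambda>t. blinfun_apply (snd (lam t)) (v + (1/2) *\<^sub>R br (fst (lam t)) v))"
    by (intro lipschitz_on_bounded_bilinear[OF bounded_bilinear_blinfun_apply f _ g]
        compact_imp_bounded compact_continuous_image lipschitz_on_continuous_on[OF f]
        lipschitz_on_continuous_on[OF g] compact_Icc)
  then show ?thesis by (simp add: hamfun_eq)
qed

end

section \<open>From the maximum principle to the vertical equation\<close>

lemma AE_lebesgue_on_interval_negligible:
  fixes I :: "real set"
  assumes "is_interval I" "AE t in lebesgue_on I. P t"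
  obtains N where "negligible N" "\<And>t. t \<in> I - N \<Longrightarrow> P t"
proof -
  have "I \<in> sets lebesgue"
    using real_interval_borel_measurable[OF assms(1)] by simp
  then have "AE t in lebesgue. t \<in> I \<longrightarrow> P t"
    using assms(2) by (simp add: AE_restrict_space_iff)
  then show thesis
  proof (rule AE_E3)
    fix N assume "\<And>t. t \<in> space lebesgue - N \<Longrightarrow> t \<in> I \<longrightarrow> P t" "N \<in> null_sets lebesgue"
    then show thesis by (intro that[of N]) (auto simp: negligible_iff_null_sets)
  qed
qed

lemma has_vector_derivative_vecI:
  fixes h :: "real \<Rightarrow> real^'n"
  assumes "\<And>i. ((\<lambda>t. h t $ i) has_real_derivative d $ i) F"
  shows "(h has_vector_derivative d) F"
proof -
  have "((\<lambda>t. \<Sum>i\<in>UNIV. (h t $ i) *\<^sub>R axis i (1::real)) has_vector_derivative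
      (\<Sum>i\<in>UNIV. (d $ i) *\<^sub>R axis i 1)) F"
    using assms
    by (intro has_vector_derivative_sum
        bounded_linear.has_vector_derivative[OF bounded_linear_scaleR_left])
      (simp add: has_real_derivative_iff_has_vector_derivative)
  then show ?thesis by (simp add: basis_expansion flip: scalar_mult_eq_scaleR)
qed

theorem corollary1:
  fixes br :: "'a::euclidean_space \<Rightarrow> 'a \<Rightarrow> 'a" and L1 L2 :: "'a set"
    and X :: "3 \<Rightarrow> 'a" and U :: "(real^3) set"
    and I :: "real set" and u :: "real \<Rightarrow> real^3"
  assumes "carnot_algebra_step2_gen3 br L1 L2"
    and "is_basis_of X L1"
    and "strictly_convex_set U" and "compact U" and "0 \<in> interior U"
    and "is_interval I" and "0 \<in> I"
    and "normal_extremal_control br X U I u"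
  shows "\<exists>v. (AE t in lebesgue_on I. u t = v t) \<and> continuous_on I v \<and>
           (v constant_on I \<or> periodic_control_on I v)"
proof -
  interpret carnot_algebra_step2_gen3 br L1 L2 by fact
  note U = assms(3-5)
  have Une: "U \<noteq> {}" using U(3) interior_subset by blast
  obtain lam c where "\<forall>t\<in>I. u t \<in> U"
    and "\<forall>a b. {a..b} \<subseteq> I \<longrightarrow> (\<exists>C. C-lipschitz_on {a..b} lam)"
    and ae: "AE t in lebesgue_on I.
           ((\<lambda>s. fst (lam s)) has_vector_derivative
              (\<Sum>i\<in>UNIV. u t $ i *\<^sub>R left_field br (X i) (fst (lam t)))) (at t within I) \<and>
           (\<forall>i. ((\<lambda>s. hamfun br (X i) (lam s)) has_real_derivative
              - (\<Sum>j\<in>UNIV. u t $ j * hamfun br (br (X i) (X j)) (lam t))) (at t within I)) \<and>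
           (\<forall>i j. ((\<lambda>s. hamfun br (br (X i) (X j)) (lam s)) has_real_derivative 0)
              (at t within I)) \<and>
           u t \<bullet> hvec br X (lam t) = support_fun U (hvec br X (lam t))"
    and "0 < c" "\<forall>t\<in>I. support_fun U (hvec br X (lam t)) = c"
    using assms(8) unfolding normal_extremal_control_def by blast
  then have uU: "\<And>t. t \<in> I \<Longrightarrow> u t \<in> U"
    and lip: "\<And>a b. {a..b} \<subseteq> I \<Longrightarrow> \<exists>C. C-lipschitz_on {a..b} lam"
    and c: "0 < c" "\<And>t. t \<in> I \<Longrightarrow> support_fun U (hvec br X (lam t)) = c"
    by blast+
  define h where "h = (\<lambda>t. hvec br X (lam t))"
  have h: "h t $ i = hamfun br (X i) (lam t)" for t i by (simp add: h_def hvec_def)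
  have lev: "support_fun U (h t) = c" if "t \<in> I" for t using c(2)[OF that] by (simp add: h_def)
  have hnz: "h t \<noteq> 0" if "t \<in> I" for t
    by (rule nonzero_if_support_fun_pos[OF U(2) Une]) (simp add: lev that c(1))
  \<comment> \<open>The continuous representative of \<open>u\<close>, defined at every
    time.\<close>
  define v where "v = (\<lambda>t. maximizer U (h t))"
  have liph: "\<exists>C. C-lipschitz_on {a..b} (\<lambda>t. hamfun br w (lam t))" if "{a..b} \<subseteq> I" for a b w
    using lip[OF that] lipschitz_on_hamfun by blast
  have "continuous_on I (\<lambda>t. \<chi> i. h t $ i)"
    unfolding h
    by (intro continuous_on_vec_lambda continuous_on_interval_if_locally_lipschitz assms(6) liph)
  then have conth: "continuous_on I h" by simp
  have contv: "continuous_on I v"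
    unfolding v_def
    by (rule continuous_on_compose2[OF continuous_on_maximizer[OF U(1,2) Une] conth])
      (use hnz in auto)
  have u_eq: "u t = v t" if "t \<in> I" "u t \<bullet> hvec br X (lam t) = support_fun U (hvec br X (lam t))" for t
    using maximizer_eqI[OF U(1,2) hnz[OF that(1)] uU[OF that(1)]] that(2) by (simp add: h_def v_def)
  obtain N where N: "negligible N"
    and der: "\<And>t i. t \<in> I - N \<Longrightarrow> ((\<lambda>s. hamfun br (X i) (lam s)) has_real_derivative
        - (\<Sum>j\<in>UNIV. u t $ j * hamfun br (br (X i) (X j)) (lam t))) (at t within I)"
    and der0: "\<And>t i j. t \<in> I - N \<Longrightarrow>
        ((\<lambda>s. hamfun br (br (X i) (X j)) (lam s)) has_real_derivative 0) (at t within I)"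
    and uN: "\<And>t. t \<in> I - N \<Longrightarrow> u t = v t"
    by (rule AE_lebesgue_on_interval_negligible[OF assms(6) ae], rule that, assumption)
      (blast intro: u_eq)+
  define A where "A = (\<lambda>i j. hamfun br (br (X i) (X j)) (lam 0))"
  \<comment> \<open>The derivative vanishes only off the null set \<open>N\<close>; Lipschitz
    continuity turns this into constancy on all of \<open>I\<close>.\<close>
  have A: "hamfun br (br (X i) (X j)) (lam t) = A i j" if t: "t \<in> I" for i j t
  proof -
    have const: "hamfun br (br (X i) (X j)) (lam a) = hamfun br (br (X i) (X j)) (lam b)"
      if ab: "a \<in> I" "b \<in> I" "a \<le> b" for a b
    proof -
      have sub: "{a..b} \<subseteq> I" using assms(6)[unfolded is_interval_1] ab by fastforce
      then obtain C where "C-lipschitz_on {a..b} (\<lambda>t. hamfun br (br (X i) (X j)) (lam t))"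
        using liph by blast
      then show ?thesis
        by (rule lipschitz_derivative_zero_ae_eq[OF _ ab(3) N])
          (rule DERIV_subset[OF der0 sub], use sub in auto)
    qed
    show ?thesis
      using const[OF t assms(7)] const[OF assms(7) t] by (cases "t \<le> 0") (auto simp: A_def)
  qed
  have anti: "A i j = - A j i" for i j by (simp add: A_def hamfun_br_anti[of "X i" "X j"])
  have A0: "A i i = 0" for i using anti[of i i] by simp
  \<comment> \<open>A skew-symmetric 3 by 3 matrix acts as a cross product; the entries are ordered
    so that \<open>cross3 \<omega>\<close> is minus the action of \<open>A\<close>.\<close>
  define \<omega> :: "real^3" where "\<omega> = vector [A 2 3, A 3 1, A 1 2]"
  have cross: "cross3 \<omega> w $ i = - (\<Sum>j\<in>UNIV. w $ j * A i j)" for w i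
    using anti[of 2 1] anti[of 3 2] anti[of 1 3] exhaust_3[of i]
    by (auto simp: cross3_def \<omega>_def sum_3 A0 algebra_simps)
  \<comment> \<open>The almost-everywhere equation holds at every interior time, because its
    right-hand side with \<open>v\<close> in place of \<open>u\<close> is continuous.\<close>
  have derh: "(h has_vector_derivative cross3 \<omega> (maximizer U (h t))) (at t)"
    if t: "t \<in> interior I" for t
  proof (rule has_vector_derivative_vecI)
    fix i
    obtain e where e: "0 < e" "cball t e \<subseteq> I" using t unfolding mem_interior_cball by blast
    then have sub: "{t - e..t + e} \<subseteq> I" by (simp add: cball_eq_atLeastAtMost)
    have "((\<lambda>s. hamfun br (X i) (lam s)) has_real_derivative cross3 \<omega> (v t) $ i) (at t)"
    proof -
      obtain C where C: "C-lipschitz_on {t - e..t + e} (\<lambda>s. hamfun br (X i) (lam s))"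
        using liph[OF sub] by blast
      have "continuous_on {t - e..t + e} (\<lambda>s. cross3 \<omega> (v s) $ i)"
        by (intro continuous_on_component continuous_on_cross continuous_on_const
            continuous_on_subset[OF contv sub])
      moreover have "((\<lambda>s. hamfun br (X i) (lam s)) has_real_derivative cross3 \<omega> (v s) $ i)
          (at s within {t - e..t + e})" if s: "s \<in> {t - e..t + e} - N" for s
      proof -
        have "s \<in> I - N" using s sub by blast
        from der[OF this, of i] have "((\<lambda>s. hamfun br (X i) (lam s)) has_real_derivative
            cross3 \<omega> (v s) $ i) (at s within I)"
          using \<open>s \<in> I - N\<close> by (simp add: cross A uN)
        then show ?thesis by (rule DERIV_subset[OF _ sub])
      qed
      ultimately show ?thesis
        by (rule lipschitz_derivative_ae_imp_derivative[OF C N]) (use e(1) in auto)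
    qed
    then show "((\<lambda>t. h t $ i) has_real_derivative cross3 \<omega> (maximizer U (h t)) $ i) (at t)"
      by (simp add: h v_def)
  qed
  have "AE t in lebesgue_on I. u t = v t"
    using ae AE_space by eventually_elim (auto intro: u_eq)
  \<comment> \<open>A constant control is in particular periodic, so this alternative covers both
    cases of the conclusion.\<close>
  moreover have "periodic_control_on I v"
    unfolding v_def
    by (rule extremal_flow_periodic_on_interval[OF U assms(6,7) contv[unfolded v_def] derh lev c(1)])
  ultimately show ?thesis using contv by blast
qed

end
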